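(* Let $b>3$ be an integer. Then, as $x\to\infty$, \[\sum_{n\leq x}\left(1-\frac{n}{x}\right)h_b(n)= \frac{\zeta(2b-1)}{6\zeta(2b)}x^2 +O_b(x\log x).\]
   Context: For an integer $b\ge 2$ and positive integers $m,n$, the generalized gcd is $(m,n)_b:=\max\{d\ge 1: d^b\mid m \text{ and } d^b\mid n\}$. The generalized gcd-sum function is $h_b(n):=\sum_{1\le j\le n}(j,n)_b$. Here $\zeta$ is the Riemann zeta function, $x$ is a real variable, sums over $n\le x$ run over positive integers $n$, and $O_b$ means that the implied constant may depend on $b$. *)

theory Defs
  imports Complex_Main "HOL-Library.Landau_Symbols"
begin

text \<open>
  The Riemann zeta function at real arguments, given by its Dirichlet series. It represents
  the zeta function only for \<open>s > 1\<close>, where the series converges.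
\<close>
definition zeta :: "real \<Rightarrow> real" where
  "zeta s = (\<Sum>n. 1 / real (Suc n) powr s)"

text \<open>
  The set below is finite for \<open>b \<ge> 1\<close> and \<open>m\<close>, \<open>n\<close> not both \<open>0\<close>; otherwise \<open>Max\<close> is not meaningful.
\<close>
definition gen_gcd :: "nat \<Rightarrow> nat \<Rightarrow> nat \<Rightarrow> nat" where
  "gen_gcd b m n = Max {d. d \<ge> 1 \<and> d ^ b dvd m \<and> d ^ b dvd n}"

definition gen_gcd_sum :: "nat \<Rightarrow> nat \<Rightarrow> nat" where
  "gen_gcd_sum b n = (\<Sum>j = 1..n. gen_gcd b j n)"

end

theory Submission
  imports Defs "HOL-Analysis.Infinite_Sum" "HOL-Analysis.Summation_Tests" "HOL-Number_Theory.Totient"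
begin

text \<open>
  Since \<open>d\<^sup>b\<close> divides both \<open>j\<close> and \<open>n\<close> exactly when \<open>d\<close> divides \<open>(j, n)\<^sub>b\<close>, the identity
  \<open>\<Sum>d | d dvd k. \<phi>(d) = k\<close> gives \<open>h\<^sub>b(n) = \<Sum>d | d\<^sup>b dvd n. \<phi>(d) n / d\<^sup>b\<close>. Hence the weighted sum
  equals \<open>\<Sum>d. \<phi>(d) R(x / d\<^sup>b)\<close> with \<open>R(y) = \<Sum>m \<le> y. (1 - m / y) m\<close>. An explicit computation
  yields \<open>\<bar>R(y) - y\<^sup>2 / 6\<bar> \<le> y / 6\<close> for all \<open>y > 0\<close>, also for \<open>y < 1\<close>, where \<open>R\<close> vanishes. So
  the sum over \<open>d\<close> may be extended to infinity, with main term
  \<open>(x\<^sup>2 / 6) \<Sum>d. \<phi>(d) / d\<^bsup>2b\<^esup>\<close> and error at most \<open>(x / 6) \<Sum>d. \<phi>(d) / d\<^sup>b = O(x)\<close>.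
\<close>

section \<open>Generalized gcds and their divisor-sum formula\<close>

lemma lcm_power_dvd:
  fixes d e g :: nat
  assumes "d ^ b dvd g" "e ^ b dvd g"
  shows "lcm d e ^ b dvd g"
proof (cases "gcd d e = 0")
  case False
  \<comment> \<open>Once \<open>c ^ b\<close> is divided out of \<open>g\<close>, the coprime powers
    \<open>d' ^ b\<close> and \<open>e' ^ b\<close> both divide the cofactor, hence so does their
    product; and the lcm is \<open>d' * e' * c\<close>.\<close>
  define c where "c = gcd d e"
  obtain d' e' where de: "d = d' * c" "e = e' * c" "coprime d' e'"
    using gcd_coprime_exists[OF False] c_def by blast
  have "c > 0" using False c_def by auto
  have "c ^ b dvd g"
    using assms(1) unfolding de(1) power_mult_distrib by (rule dvd_mult_right)
  then obtain k where k: "g = c ^ b * k" ..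
  have "d' ^ b dvd k" "e' ^ b dvd k"
    using assms \<open>c > 0\<close> unfolding de k by (simp_all add: power_mult_distrib mult.commute)
  then have "d' ^ b * e' ^ b dvd k"
    by (simp add: de(3) divides_mult)
  moreover have "lcm d e = d' * e' * c"
    unfolding de(1,2) using lcm_coprime[OF de(3)]
    by (simp add: lcm_mult_right lcm.commute)
  ultimately show ?thesis
    unfolding k by (simp add: power_mult_distrib mult.commute)
qed (use assms in auto)

text \<open>The admissible \<open>d\<close> are closed under lcm, so the lcm of any of them with the
  maximum is again admissible, hence equal to the maximum. This turns a definition by size into one
  by divisibility.\<close>

lemma dvd_gen_gcd_iff:
  assumes "n > 0" "b > 0"
  shows "d dvd gen_gcd b m n \<longleftrightarrow> d ^ b dvd m \<and> d ^ b dvd n"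
proof -
  define S where "S = {d. d \<ge> 1 \<and> d ^ b dvd m \<and> d ^ b dvd n}"
  have "d \<le> n" if "d \<in> S" for d
  proof -
    have "d \<le> d ^ b"
      using that assms self_le_power[of d b] by (auto simp: S_def)
    also have "\<dots> \<le> n"
      using that assms dvd_imp_le by (auto simp: S_def)
    finally show ?thesis .
  qed
  then have fin: "finite S"
    by (meson atMost_iff finite_atMost finite_subset subsetI)
  define M where "M = gen_gcd b m n"
  have M: "M = Max S"
    by (simp add: M_def gen_gcd_def S_def)
  have "1 \<in> S" by (auto simp: S_def)
  then have MS: "M \<in> S" unfolding M using fin Max_in by blast
  have "d dvd M" if d: "d ^ b dvd m" "d ^ b dvd n"
  proof -
    have "d \<noteq> 0" using d assms by (auto simp: power_0_left)
    then have "lcm d M \<in> S"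
      using d MS lcm_power_dvd[of d b _ M] by (auto simp: S_def Suc_le_eq lcm_pos_nat)
    then have "lcm d M \<le> M" unfolding M using fin Max_ge by blast
    moreover have "M > 0" using MS by (auto simp: S_def)
    ultimately have "lcm d M = M"
      using \<open>d \<noteq> 0\<close> by (meson dvd_imp_le dvd_lcm2 lcm_pos_nat le_antisym neq0_conv)
    then show ?thesis by (metis dvd_lcm1)
  qed
  moreover have "d ^ b dvd m" "d ^ b dvd n" if "d dvd M"
    using that MS dvd_power_same[of d M b] dvd_trans by (auto simp: S_def)
  ultimately show ?thesis unfolding M_def by blast
qed

lemma bij_betw_multiples:
  fixes k :: nat
  assumes "k > 0"
  shows "bij_betw (\<lambda>m. k * m) {1..N div k} {n \<in> {1..N}. k dvd n}"
proof (rule bij_betw_byWitness[where f' = "\<lambda>n. n div k"])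
  show "(\<lambda>m. k * m) ` {1..N div k} \<subseteq> {n \<in> {1..N}. k dvd n}"
    using assms by (auto simp: less_eq_div_iff_mult_less_eq mult.commute)
  show "(\<lambda>n. n div k) ` {n \<in> {1..N}. k dvd n} \<subseteq> {1..N div k}"
    using assms by (auto simp: div_le_mono Suc_le_eq div_greater_zero_iff dvd_imp_le)
qed (use assms in auto)

text \<open>Expand each gcd as the totient sum over its divisors, swap the sums and count multiples
  of \<open>d ^ b\<close>. The bound \<open>N\<close> makes the range of \<open>d\<close>
  independent of \<open>n\<close>, ready for a later swap with a sum over \<open>n\<close>; no
  \<open>d\<close> is lost because \<open>d \<le> d ^ b \<le> n\<close>.\<close>

lemma gen_gcd_sum_eq:
  assumes "0 < n" "n \<le> N" "b > 0"
  shows "gen_gcd_sum b n = (\<Sum>d | d \<in> {1..N} \<and> d ^ b dvd n. totient d * (n div d ^ b))"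
proof -
  have le: "d \<le> n" "0 < d" if "d ^ b dvd n" for d
  proof -
    show "0 < d"
      using that assms by (cases "d = 0") (auto simp: power_0_left)
    then have "d \<le> d ^ b"
      using assms self_le_power[of d b] by auto
    also have "\<dots> \<le> n"
      using that assms dvd_imp_le by auto
    finally show "d \<le> n" .
  qed
  have "gen_gcd_sum b n = (\<Sum>j=1..n. \<Sum>d | d \<in> {1..N} \<and> d ^ b dvd j \<and> d ^ b dvd n. totient d)"
    unfolding gen_gcd_sum_def
  proof (intro sum.cong refl)
    fix j
    have "gen_gcd b j n = (\<Sum>d | d dvd gen_gcd b j n. totient d)"
      by (rule totient_divisor_sum[symmetric])
    also have "{d. d dvd gen_gcd b j n} = {d. d \<in> {1..N} \<and> d ^ b dvd j \<and> d ^ b dvd n}"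
      using assms le by (fastforce simp: dvd_gen_gcd_iff Suc_le_eq)
    finally show "gen_gcd b j n = (\<Sum>d | d \<in> {1..N} \<and> d ^ b dvd j \<and> d ^ b dvd n. totient d)" .
  qed
  also have "\<dots> = (\<Sum>j=1..n. \<Sum>d | d \<in> {d \<in> {1..N}. d ^ b dvd n} \<and> d ^ b dvd j. totient d)"
    by (intro sum.cong refl) auto
  also have "\<dots> = (\<Sum>d | d \<in> {1..N} \<and> d ^ b dvd n. \<Sum>j | j \<in> {1..n} \<and> d ^ b dvd j. totient d)"
    by (subst sum.swap_restrict) auto
  also have "\<dots> = (\<Sum>d | d \<in> {1..N} \<and> d ^ b dvd n. totient d * (n div d ^ b))"
  proof (intro sum.cong refl)
    fix d assume d: "d \<in> {d. d \<in> {1..N} \<and> d ^ b dvd n}"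
    then have "card {j. j \<in> {1..n} \<and> d ^ b dvd j} = n div d ^ b"
      using bij_betw_same_card[OF bij_betw_multiples[of "d ^ b" n]] by simp
    then show "(\<Sum>j | j \<in> {1..n} \<and> d ^ b dvd j. totient d) = totient d * (n div d ^ b)"
      by simp
  qed
  finally show ?thesis .
qed

section \<open>Riesz means of the identity and the reduction of the weighted sum to them\<close>

definition riesz_sum :: "real \<Rightarrow> real" where
  "riesz_sum y = (\<Sum>m = 1..nat \<lfloor>y\<rfloor>. (1 - real m / y) * real m)"

lemma riesz_sum_approx:
  assumes "y > 0"
  shows "\<bar>riesz_sum y - y\<^sup>2 / 6\<bar> \<le> y / 6"
proof -
  define N where "N = nat \<lfloor>y\<rfloor>"
  define t where "t = y - real N"
  have t: "0 \<le> t" "t < 1" and y: "y = real N + t"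
    using assms by (simp_all add: t_def N_def) linarith+
  \<comment> \<open>The upper limit \<open>M\<close> is decoupled from \<open>y\<close> so that
    induction applies; the factor \<open>6 * y\<close> clears all denominators.\<close>
  have closed: "6 * y * (\<Sum>m = 1..M. (1 - real m / y) * real m)
      = real M * (real M + 1) * (3 * y - 2 * real M - 1)" for M
  proof (induction M)
    case (Suc M)
    have "6 * y * ((1 - real (Suc M) / y) * real (Suc M)) = 6 * (y - real (Suc M)) * real (Suc M)"
      using assms by (simp add: field_simps del: of_nat_Suc)
    with Suc show ?case by (simp add: distrib_left) (simp add: algebra_simps)
  qed simp
  have eq: "6 * y * (riesz_sum y - y\<^sup>2 / 6) = 3 * real N * t * (1 - t) - real N - t ^ 3"
    unfolding riesz_sum_def N_def[symmetric] right_diff_distrib closed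
    by (simp add: y algebra_simps power2_eq_square power3_eq_cube)
  \<comment> \<open>This serves the lower bound, as \<open>t ^ 3 \<le> t\<^sup>2\<close>.
    Integrality gives \<open>N \<le> N\<^sup>2\<close>; for \<open>N = 0\<close>, that is
    \<open>y < 1\<close>, it is an equality.\<close>
  have sq: "real N + t\<^sup>2 \<le> y\<^sup>2"
  proof (cases N)
    case (Suc k)
    then have "real N \<le> (real N)\<^sup>2" by (simp add: power2_eq_square)
    moreover have "0 \<le> 2 * real N * t" using t by simp
    ultimately show ?thesis unfolding y power2_sum by linarith
  qed (simp add: y)
  have "t ^ 3 \<le> t\<^sup>2" "0 \<le> t ^ 3"
    using t by (auto intro: power_decreasing)
  moreover have "0 \<le> real N * (t * (1 - t))" using t by simp
  \<comment> \<open>Hence \<open>3 * N * t * (1 - t)\<close> is at most \<open>3 * N / 4\<close>,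
    and the right-hand side of \<open>eq\<close> is never positive.\<close>
  moreover have "t * (1 - t) \<le> 1 / 4"
    using zero_le_power2[of "t - 1 / 2"] by (simp add: power2_eq_square algebra_simps)
  then have "real N * (t * (1 - t)) \<le> real N * (1 / 4)"
    by (intro mult_left_mono) auto
  ultimately have "\<bar>6 * y * (riesz_sum y - y\<^sup>2 / 6)\<bar> \<le> y\<^sup>2"
    unfolding eq using sq zero_le_power2[of t] of_nat_0_le_iff[of N, where 'a = real]
    unfolding abs_le_iff mult.assoc by linarith
  then have "6 * y * \<bar>riesz_sum y - y\<^sup>2 / 6\<bar> \<le> 6 * y * (y / 6)"
    using assms by (simp add: abs_mult power2_eq_square)
  then show ?thesis
    using assms by (subst (asm) mult_le_cancel_left_pos) auto
qed

lemma riesz_sum_eq_0: "y < 1 \<Longrightarrow> riesz_sum y = 0"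
  by (simp add: riesz_sum_def)

text \<open>After swapping the sums, put \<open>n = d ^ b * m\<close>: the cofactor is
  \<open>m\<close> and the weight becomes \<open>1 - m / y\<close> with
  \<open>y = x / d ^ b\<close>.\<close>

lemma riesz_gen_gcd_sum_eq:
  assumes "x > 0" "b > 0"
  shows "(\<Sum>n | 1 \<le> n \<and> real n \<le> x. (1 - real n / x) * real (gen_gcd_sum b n))
       = (\<Sum>d = 1..nat \<lfloor>x\<rfloor>. real (totient d) * riesz_sum (x / real d ^ b))"
proof -
  define N where "N = nat \<lfloor>x\<rfloor>"
  have "{n. 1 \<le> n \<and> real n \<le> x} = {1..N}"
    using assms by (auto simp: N_def le_nat_floor) linarith
  then have "(\<Sum>n | 1 \<le> n \<and> real n \<le> x. (1 - real n / x) * real (gen_gcd_sum b n))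
     = (\<Sum>n = 1..N. \<Sum>d | d \<in> {1..N} \<and> d ^ b dvd n.
          (1 - real n / x) * (real (totient d) * real (n div d ^ b)))"
    using assms by (simp add: gen_gcd_sum_eq[of _ N] sum_distrib_left)
  also have "\<dots> = (\<Sum>d = 1..N. \<Sum>n | n \<in> {1..N} \<and> d ^ b dvd n.
          (1 - real n / x) * (real (totient d) * real (n div d ^ b)))"
    by (rule sum.swap_restrict) auto
  also have "\<dots> = (\<Sum>d = 1..N. real (totient d) * riesz_sum (x / real d ^ b))"
  proof (intro sum.cong refl)
    fix d assume "d \<in> {1..N}"
    then have d: "d > 0" by auto
    \<comment> \<open>Division by a positive integer commutes with the floor, so the range of
      \<open>m\<close> is that of the multiples of \<open>d ^ b\<close> up to
      \<open>N\<close>.\<close>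
    have "nat \<lfloor>x / real d ^ b\<rfloor> = N div d ^ b"
      using floor_divide_real_eq_div[of "int (d ^ b)" x] assms
      by (simp add: N_def nat_div_distrib nat_power_eq)
    then have "real (totient d) * riesz_sum (x / real d ^ b)
        = (\<Sum>m = 1..N div d ^ b. (1 - real (d ^ b * m) / x)
            * (real (totient d) * real (d ^ b * m div d ^ b)))"
      using d by (simp add: riesz_sum_def sum_distrib_left mult_ac)
    also have "\<dots> = (\<Sum>n | n \<in> {1..N} \<and> d ^ b dvd n.
          (1 - real n / x) * (real (totient d) * real (n div d ^ b)))"
      using d by (intro sum.reindex_bij_betw bij_betw_multiples) simp
    finally show "(\<Sum>n | n \<in> {1..N} \<and> d ^ b dvd n.
          (1 - real n / x) * (real (totient d) * real (n div d ^ b)))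
          = real (totient d) * riesz_sum (x / real d ^ b)" ..
  qed
  finally show ?thesis by (simp add: N_def)
qed

section \<open>The Dirichlet series of the totient function\<close>

lemma has_sum_zeta:
  assumes "k > 1"
  shows "((\<lambda>n. 1 / real n ^ k) has_sum zeta (real k)) {0<..}"
proof -
  have eq: "1 / real (Suc n) powr real k = 1 / real (Suc n) ^ k" for n
    by (simp add: powr_realpow del: of_nat_Suc)
  have "summable (\<lambda>n. 1 / real (Suc n) ^ k)"
    using inverse_power_summable[of k, where 'a = real] assms
      summable_Suc_iff[of "\<lambda>n. 1 / real n ^ k"]
    by (simp add: inverse_eq_divide del: of_nat_Suc)
  \<comment> \<open>Absolute convergence turns the ordered series into an unconditional sum, as
    needed for rearranging double sums.\<close>
  then have "((\<lambda>n. 1 / real (Suc n) ^ k) has_sum zeta (real k)) UNIV"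
    by (subst zeta_def, subst eq)
       (intro norm_summable_imp_has_sum summable_sums, simp_all)
  then show ?thesis
    using has_sum_reindex[of Suc UNIV "\<lambda>n. 1 / real n ^ k" "zeta (real k)"]
    by (simp add: comp_def greaterThan_0 del: of_nat_Suc)
qed

lemma summable_on_totient:
  assumes "k > 2"
  shows "(\<lambda>d. real (totient d) / real d ^ k) summable_on {0<..}"
proof (rule summable_on_comparison_test)
  show "(\<lambda>d. 1 / real d ^ (k - 1)) summable_on {0<..}"
    using assms by (intro has_sum_imp_summable[OF has_sum_zeta]) simp
  fix d :: nat assume "d \<in> {0<..}"
  then have "real (totient d) / real d ^ k \<le> real d / real d ^ k"
    by (intro divide_right_mono) (auto simp: totient_le)
  also have "\<dots> = 1 / real d ^ (k - 1)"
    using \<open>d \<in> _\<close> assms by (cases k) auto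
  finally show "real (totient d) / real d ^ k \<le> 1 / real d ^ (k - 1)" .
qed auto

text \<open>Multiply the series by \<open>zeta k\<close> and group the double sum by
  \<open>n = d * m\<close>: the divisor sum of the totient is \<open>n\<close>, which leaves the
  series of \<open>zeta (k - 1)\<close>.\<close>

lemma has_sum_totient:
  assumes "k > 2"
  shows "((\<lambda>d. real (totient d) / real d ^ k) has_sum zeta (real k - 1) / zeta (real k)) {0<..}"
proof -
  define S where "S = infsum (\<lambda>d. real (totient d) / real d ^ k) {0<..}"
  have S: "((\<lambda>d. real (totient d) / real d ^ k) has_sum S) {0<..}"
    unfolding S_def by (rule has_sum_infsum[OF summable_on_totient[OF assms]])
  have z: "((\<lambda>n. 1 / real n ^ k) has_sum zeta (real k)) {0<..}"
    using assms by (intro has_sum_zeta) auto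
  define F where "F = (\<lambda>(d, m). real (totient d) / real d ^ k * (1 / real m ^ k))"
  have row: "((\<lambda>m. F (d, m)) has_sum (real (totient d) / real d ^ k * zeta (real k))) {0<..}"
    if "d \<in> {0<..}" for d
    unfolding F_def prod.case by (rule has_sum_cmult_right[OF z])
  have tot: "((\<lambda>d. real (totient d) / real d ^ k * zeta (real k)) has_sum (S * zeta (real k))) {0<..}"
    by (rule has_sum_cmult_left[OF S])
  \<comment> \<open>Since \<open>F\<close> is nonnegative, summability of the row sums
    suffices.\<close>
  have "F summable_on ({0<..} \<times> {0<..})"
    by (rule summable_on_SigmaI[OF row]) (use tot in \<open>auto simp: summable_on_def F_def\<close>)
  then have F: "(F has_sum (S * zeta (real k))) ({0<..} \<times> {0<..})"
    using has_sum_SigmaI[OF row tot] by simp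
  have "(F has_sum (S * zeta (real k))) ({0<..} \<times> {0<..}) \<longleftrightarrow>
    ((\<lambda>(n, d). real (totient d) / real n ^ k) has_sum (S * zeta (real k)))
      (SIGMA n:{0<..}. {d. d dvd n})"
    by (rule has_sum_reindex_bij_witness[where i = "\<lambda>(n, d). (d, n div d)" and j = "\<lambda>(d, m). (d * m, d)"])
       (auto simp: F_def power_mult_distrib dvd_imp_le div_greater_zero_iff intro!: Nat.gr0I)
  with F have "((\<lambda>(n, d). real (totient d) / real n ^ k) has_sum (S * zeta (real k)))
      (SIGMA n:{0<..}. {d. d dvd n})"
    by blast
  then have "((\<lambda>n. 1 / real n ^ (k - 1)) has_sum (S * zeta (real k))) {0<..}"
  proof (rule has_sum_SigmaD)
    fix n :: nat assume n: "n \<in> {0<..}"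
    have "(\<Sum>d | d dvd n. real (totient d) / real n ^ k) = real n / real n ^ k"
      by (simp add: sum_divide_distrib[symmetric] of_nat_sum[symmetric] totient_divisor_sum
               del: of_nat_sum)
    also have "\<dots> = 1 / real n ^ (k - 1)"
      using n assms by (cases k) auto
    finally show "((\<lambda>d. case (n, d) of (n, d) \<Rightarrow> real (totient d) / real n ^ k)
        has_sum 1 / real n ^ (k - 1)) {d. d dvd n}"
      using n by (intro has_sum_finiteI) auto
  qed
  moreover have "((\<lambda>n. 1 / real n ^ (k - 1)) has_sum zeta (real (k - 1))) {0<..}"
    using assms by (intro has_sum_zeta) auto
  ultimately have "S * zeta (real k) = zeta (real k - 1)"
    using has_sum_unique assms by (fastforce simp: of_nat_diff)
  \<comment> \<open>The term \<open>n = 1\<close> alone contributes 1; this permits the division by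
    \<open>zeta k\<close>.\<close>
  moreover have "zeta (real k) > 0"
  proof -
    have "(\<Sum>n\<in>{1}. 1 / real n ^ k) \<le> zeta (real k)"
      by (rule finite_sum_le_has_sum[OF z]) auto
    then show ?thesis by simp
  qed
  ultimately have "S = zeta (real k - 1) / zeta (real k)" by (simp add: field_simps)
  with S show ?thesis by simp
qed

section \<open>Main term and error bound by summation over all \<open>d\<close>\<close>

theorem theorem1p2:
  fixes b :: nat
  assumes "b > 3"
  shows "(\<lambda>x::real. (\<Sum>n | 1 \<le> n \<and> real n \<le> x. (1 - real n / x) * real (gen_gcd_sum b n))
            - zeta (2 * real b - 1) / (6 * zeta (2 * real b)) * x ^ 2)
         \<in> O[at_top](\<lambda>x. x * ln x)"
proof -
  define c where "c = zeta (2 * real b - 1) / zeta (2 * real b)"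
  define a where "a = infsum (\<lambda>d. real (totient d) / real d ^ b) {0<..}"
  let ?lhs = "\<lambda>x::real. \<Sum>n | 1 \<le> n \<and> real n \<le> x. (1 - real n / x) * real (gen_gcd_sum b n)"
  have a: "((\<lambda>d. real (totient d) / real d ^ b) has_sum a) {0<..}"
    unfolding a_def using assms by (intro has_sum_infsum summable_on_totient) auto
  have c: "((\<lambda>d. real (totient d) / real d ^ (2 * b)) has_sum c) {0<..}"
    using has_sum_totient[of "2 * b"] assms by (simp add: c_def)
  have bound: "\<bar>?lhs x - c * x\<^sup>2 / 6\<bar> \<le> a * x / 6" if x: "x > 0" for x
  proof -
    define E where "E = (\<lambda>d. real (totient d) * riesz_sum (x / real d ^ b))"
    have "(E has_sum ?lhs x) {1..nat \<lfloor>x\<rfloor>}"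
      unfolding E_def using x assms by (intro has_sum_finiteI riesz_gen_gcd_sum_eq) auto
    \<comment> \<open>For \<open>d > x\<close> the argument \<open>x / d ^ b\<close> is below 1, so
      the finite sum extends to all positive \<open>d\<close>.\<close>
    moreover have "E d = 0" if "d > nat \<lfloor>x\<rfloor>" for d
    proof -
      have "x < real d" using that by linarith
      also have "real d \<le> real d ^ b"
        using that assms by (intro self_le_power) auto
      finally have "riesz_sum (x / real d ^ b) = 0"
        using x by (intro riesz_sum_eq_0) (simp add: divide_less_eq)
      then show ?thesis by (simp add: E_def)
    qed
    ultimately have "(E has_sum ?lhs x) {0<..}"
      by (subst has_sum_cong_neutral[where T = "{1..nat \<lfloor>x\<rfloor>}" and g = E]) (auto simp: not_le)
    moreover have "((\<lambda>d. real (totient d) / real d ^ (2 * b) * (x\<^sup>2 / 6)) has_sum (c * (x\<^sup>2 / 6))) {0<..}"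
      by (rule has_sum_cmult_left[OF c])
    ultimately have D: "((\<lambda>d. E d - real (totient d) / real d ^ (2 * b) * (x\<^sup>2 / 6))
        has_sum (?lhs x - c * (x\<^sup>2 / 6))) {0<..}"
      using has_sum_add has_sum_uminusI by fastforce
    have A: "((\<lambda>d. real (totient d) / real d ^ b * (x / 6)) has_sum (a * (x / 6))) {0<..}"
      by (rule has_sum_cmult_left[OF a])
    \<comment> \<open>\<open>riesz_sum_approx\<close> is applied for every \<open>d\<close>; where
      \<open>E d = 0\<close> it bounds the tail of the main term.\<close>
    have "\<bar>E d - real (totient d) / real d ^ (2 * b) * (x\<^sup>2 / 6)\<bar>
        \<le> real (totient d) / real d ^ b * (x / 6)" if "d \<in> {0<..}" for d
    proof -
      have "E d - real (totient d) / real d ^ (2 * b) * (x\<^sup>2 / 6)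
          = real (totient d) * (riesz_sum (x / real d ^ b) - (x / real d ^ b)\<^sup>2 / 6)"
        by (simp add: E_def power_divide right_diff_distrib power_mult[symmetric] mult.commute)
      moreover have "\<bar>riesz_sum (x / real d ^ b) - (x / real d ^ b)\<^sup>2 / 6\<bar> \<le> x / real d ^ b / 6"
        using x that by (intro riesz_sum_approx) auto
      then have "real (totient d) * \<bar>riesz_sum (x / real d ^ b) - (x / real d ^ b)\<^sup>2 / 6\<bar>
          \<le> real (totient d) * (x / real d ^ b / 6)"
        by (intro mult_left_mono) auto
      ultimately show ?thesis by (simp add: abs_mult)
    qed
    then have "\<bar>?lhs x - c * (x\<^sup>2 / 6)\<bar> \<le> a * (x / 6)"
      using norm_infsum_le[OF D A] by simp
    then show ?thesis by simp
  qed
  have "(\<lambda>x. ?lhs x - zeta (2 * real b - 1) / (6 * zeta (2 * real b)) * x ^ 2) \<in> O[at_top](\<lambda>x. x)"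
  proof (rule bigoI[where c = "a / 6"], rule eventually_mono[OF eventually_gt_at_top[of 0]])
    fix x :: real assume "x > 0"
    then show "norm (?lhs x - zeta (2 * real b - 1) / (6 * zeta (2 * real b)) * x ^ 2) \<le> a / 6 * norm x"
      using bound[of x] by (simp add: c_def mult.commute)
  qed
  \<comment> \<open>From \<open>x = exp 1\<close> on, \<open>ln x\<close> is at least 1.\<close>
  also have "(\<lambda>x::real. x) \<in> O[at_top](\<lambda>x. x * ln x)"
  proof (rule bigoI[where c = 1], rule eventually_mono[OF eventually_ge_at_top[of "exp 1"]])
    fix x :: real assume x: "x \<ge> exp 1"
    then have "x > 0" using exp_gt_zero[of 1] by linarith
    with x have "ln x \<ge> 1" by (simp add: ln_ge_iff)
    with \<open>x > 0\<close> show "norm x \<le> 1 * norm (x * ln x)" by (simp add: abs_mult)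
  qed
  finally show ?thesis .
qed
end
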